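(* For each $r \in \{20, 25, 30, 35, 40\}$ there exists a pentagonal geometry $\mathrm{PENT}(5,r)$ with no opposite line pairs.
   Context: A partial linear space is a non-empty finite set of points together with a collection of subsets, called lines (or blocks), such that every line contains at least two points and any two distinct points lie together on at most one line. Two distinct points are collinear if some line contains both. For integers $k \ge 2$, $r \ge 1$, a pentagonal geometry $\mathrm{PENT}(k,r)$ is a partial linear space in which every line contains exactly $k$ points, every point lies on exactly $r$ lines, and for each point $x$ there is a line, denoted $x^{\mathrm{opp}}$, consisting of precisely those points $y \ne x$ that are not collinear with $x$. An opposite line pair is an unordered pair of disjoint lines such that for each point $x$ on one of the two lines, $x^{\mathrm{opp}}$ is the other line. *)

theory Defs
  imports Main
begin

locale partial_linear_space =
  fixes points :: "'a set" and lns :: "'a set set"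
  assumes points_nonempty: "points \<noteq> {}"
    and finite_points: "finite points"
    and line_subset: "l \<in> lns \<Longrightarrow> l \<subseteq> points"
    and line_card: "l \<in> lns \<Longrightarrow> 2 \<le> card l"
    and line_unique:
      "x \<in> points \<Longrightarrow> y \<in> points \<Longrightarrow> x \<noteq> y \<Longrightarrow>
        l \<in> lns \<Longrightarrow> m \<in> lns \<Longrightarrow> {x, y} \<subseteq> l \<Longrightarrow> {x, y} \<subseteq> m \<Longrightarrow> l = m"

definition collinear_points :: "'a set set \<Rightarrow> 'a \<Rightarrow> 'a \<Rightarrow> bool" where
  "collinear_points lns x y \<longleftrightarrow> x \<noteq> y \<and> (\<exists>l\<in>lns. x \<in> l \<and> y \<in> l)"

text \<open>The point set \<open>x\<^sup>o\<^sup>p\<^sup>p\<close>; that it is a line is an axiom of pentagonal geometries below.\<close>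

definition opp :: "'a set \<Rightarrow> 'a set set \<Rightarrow> 'a \<Rightarrow> 'a set" where
  "opp points lns x = {y \<in> points. y \<noteq> x \<and> \<not> collinear_points lns x y}"

locale pentagonal_geometry = partial_linear_space points lns
  for k r :: nat and points :: "'a set" and lns :: "'a set set" +
  assumes k_ge_2: "2 \<le> k"
    and r_ge_1: "1 \<le> r"
    and line_size: "l \<in> lns \<Longrightarrow> card l = k"
    and point_degree: "x \<in> points \<Longrightarrow> card {l \<in> lns. x \<in> l} = r"
    and opp_line: "x \<in> points \<Longrightarrow> opp points lns x \<in> lns"

definition opposite_line_pairs :: "'a set \<Rightarrow> 'a set set \<Rightarrow> 'a set set set" where
  "opposite_line_pairs points lns =
    {{l, m} | l m. l \<in> lns \<and> m \<in> lns \<and> l \<inter> m = {} \<and>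
      (\<forall>x\<in>l. opp points lns x = m) \<and> (\<forall>x\<in>m. opp points lns x = l)}"

end

theory Submission
  imports Defs
begin

text \<open>
  The points are the residues modulo \<open>n = 2p\<close>, with \<open>p = 2r + 3\<close>, and the lines are the translates of a few
  base blocks under \<open>x \<mapsto> x + 2\<close>. Every point is translated to 0 or to 1, so all axioms follow if, for
  \<open>s \<in> {0, 1}\<close>, the remaining points of the \<open>r\<close> lines through \<open>s\<close>, together with \<open>s\<close> itself and one further
  base block (which becomes the opposite line of \<open>s\<close>), list each residue exactly once.

  For \<open>r > 20\<close> the opposite lines are taken of constant parity: \<open>2d + 1\<close> is opposite to 0 for five differences
  \<open>d\<close>. For \<open>r = 20\<close> this is impossible, since the six remaining base blocks cover at most 36 of the 38
  remaining differences between points of unequal parity; there two of the five points opposite to \<open>s\<close> have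
  the parity of \<open>s\<close>. The base blocks were found by computer search.
\<close>

section \<open>Pentagonal geometries from the pencils of their points\<close>

text \<open>Disjoint non-empty lists have different sets, and inserting a common new point keeps
  them apart. So the degree of a point can be read off as the length of its pencil.\<close>

lemma card_image_insert_eq_length:
  assumes "distinct (concat Ts)" "x \<notin> set (concat Ts)" "[] \<notin> set Ts"
  shows "card ((\<lambda>T. insert x (set T)) ` set Ts) = length Ts"
proof -
  have inj: "inj_on (\<lambda>T. insert x (set T)) (set Ts)"
  proof (rule inj_onI, rule ccontr)
    fix T U assume T: "T \<in> set Ts" and U: "U \<in> set Ts" and "T \<noteq> U"
      and eq: "insert x (set T) = insert x (set U)"
    then have "set T \<inter> set U = {}"
      using assms(1) by (simp add: distinct_concat_iff)
    moreover have "set T = set U"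
      using eq T U assms(2) by (auto simp: insert_ident)
    ultimately show False
      using T assms(3) by auto
  qed
  have "distinct Ts"
    using assms(1,3) by (simp add: distinct_concat_iff)
  with inj show ?thesis
    by (simp add: card_image distinct_card)
qed

text \<open>Each point \<open>x\<close> comes with the list \<open>Ts x\<close> of its lines, \<open>x\<close> itself removed from them, and with
  the list \<open>N x\<close> that will be its opposite line.\<close>

lemma pentagonal_geometryI:
  fixes points :: "'a set" and lns :: "'a set set"
  assumes "points \<noteq> {}" "1 \<le> r" "2 \<le> k"
    and fin: "finite points"
    and sub: "\<And>l. l \<in> lns \<Longrightarrow> l \<subseteq> points"
    and size: "\<And>l. l \<in> lns \<Longrightarrow> card l = k"
    and lines: "\<And>x. x \<in> points \<Longrightarrow> {l \<in> lns. x \<in> l} = (\<lambda>T. insert x (set T)) ` set (Ts x)"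
    and len: "\<And>x. x \<in> points \<Longrightarrow> length (Ts x) = r"
    and dist: "\<And>x. x \<in> points \<Longrightarrow> distinct (x # N x @ concat (Ts x))"
    and cover: "\<And>x. x \<in> points \<Longrightarrow> set (x # N x @ concat (Ts x)) = points"
    and N: "\<And>x. x \<in> points \<Longrightarrow> set (N x) \<in> lns"
  shows "pentagonal_geometry k r points lns"
    and "\<And>x. x \<in> points \<Longrightarrow> opp points lns x = set (N x)"
proof -
  have in_star: "l \<in> (\<lambda>T. insert x (set T)) ` set (Ts x)" if "x \<in> points" "l \<in> lns" "x \<in> l" for x l
    using that lines[of x] by blast
  have opp: "opp points lns x = set (N x)" if x: "x \<in> points" for x
  proof -
    have "collinear_points lns x y \<longleftrightarrow> x \<noteq> y \<and> y \<in> set (concat (Ts x))" for y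
    proof -
      have "(\<exists>l\<in>lns. x \<in> l \<and> y \<in> l) \<longleftrightarrow> (\<exists>l\<in>{l \<in> lns. x \<in> l}. y \<in> l)"
        by blast
      also have "\<dots> \<longleftrightarrow> (\<exists>T\<in>set (Ts x). y \<in> insert x (set T))"
        unfolding lines[OF x] by blast
      finally show ?thesis
        by (auto simp: collinear_points_def)
    qed
    then have "opp points lns x = points - insert x (set (concat (Ts x)))"
      by (auto simp: opp_def)
    also have "\<dots> = set (N x)"
      using dist[OF x] cover[OF x] by auto
    finally show ?thesis .
  qed
  then show "\<And>x. x \<in> points \<Longrightarrow> opp points lns x = set (N x)" .
  show "pentagonal_geometry k r points lns"
  proof
    show "points \<noteq> {}" "finite points" "2 \<le> k" "1 \<le> r" by fact+
    show "l \<subseteq> points" "card l = k" "2 \<le> card l" if "l \<in> lns" for l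
      using sub size \<open>2 \<le> k\<close> that by auto
    show "opp points lns x \<in> lns" if "x \<in> points" for x
      using N opp that by simp
    show "card {l \<in> lns. x \<in> l} = r" if x: "x \<in> points" for x
    proof -
      have "[] \<notin> set (Ts x)"
      proof
        assume "[] \<in> set (Ts x)"
        then have "{x} \<in> (\<lambda>T. insert x (set T)) ` set (Ts x)"
          by force
        then have "{x} \<in> lns"
          using lines[OF x] by blast
        then show False
          using size[of "{x}"] \<open>2 \<le> k\<close> by simp
      qed
      then show ?thesis
        using dist[OF x] len[OF x] by (simp add: lines[OF x] card_image_insert_eq_length)
    qed
    show "l = m" if "x \<in> points" "x \<noteq> y" "l \<in> lns" "m \<in> lns" "{x, y} \<subseteq> l" "{x, y} \<subseteq> m" for x y l m
    proof -
      have "x \<in> l" "x \<in> m"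
        using that by auto
      with in_star[of x l] in_star[of x m] that(1,3,4)
      obtain T U where T: "T \<in> set (Ts x)" "l = insert x (set T)"
        and U: "U \<in> set (Ts x)" "m = insert x (set U)"
        by blast
      have "set T \<inter> set U = {}" if "T \<noteq> U"
        using dist[OF \<open>x \<in> points\<close>] T(1) U(1) that by (simp add: distinct_concat_iff)
      moreover have "y \<in> set T \<inter> set U"
        using that T U by auto
      ultimately have "T = U"
        by blast
      then show ?thesis
        using T U by simp
    qed
  qed
qed

section \<open>Even translations of residues and the pencils of base blocks\<close>

definition shift :: "nat \<Rightarrow> nat \<Rightarrow> nat \<Rightarrow> nat" where
  "shift n j x = (x + 2 * j) mod n"

definition develop :: "nat \<Rightarrow> nat list list \<Rightarrow> nat set set" where
  "develop n bs = {shift n j ` set B | j B. B \<in> set bs}"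

text \<open>For \<open>s \<le> 1\<close>, the lines through \<open>s\<close> with \<open>s\<close> removed: a point \<open>a \<equiv> s (mod 2)\<close> of a base block
  is carried to \<open>s\<close> by the shift by \<open>- (a div 2)\<close>, written as \<open>n - a div 2\<close> to avoid truncation.\<close>

definition pencil :: "nat \<Rightarrow> nat list list \<Rightarrow> nat \<Rightarrow> nat list list" where
  "pencil n bs s = concat (map (\<lambda>B. map (\<lambda>a. map (shift n (n - a div 2)) (remove1 a B))
     (filter (\<lambda>a. a mod 2 = s) B)) bs)"

text \<open>The first two base blocks serve as the opposite lines of the points 0 and 1.\<close>

definition opp_list :: "nat \<Rightarrow> nat list list \<Rightarrow> nat \<Rightarrow> nat list" where
  "opp_list n bs x = map (shift n (x div 2)) (bs ! (x mod 2))"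

text \<open>The equation on \<open>sort\<close> expresses distinctness and coverage at once, in a
  form that can be evaluated.\<close>

definition pent_base :: "nat \<Rightarrow> nat \<Rightarrow> nat \<Rightarrow> nat list list \<Rightarrow> bool" where
  "pent_base n k r bs \<longleftrightarrow> even n \<and> 2 \<le> n \<and> 2 \<le> k \<and> 1 \<le> r \<and> 2 \<le> length bs \<and>
    (\<forall>B\<in>set bs. length B = k \<and> distinct B \<and> (\<forall>a\<in>set B. a < n)) \<and>
    (\<forall>s\<in>{0, 1}. length (pencil n bs s) = r \<and>
      sort (s # bs ! s @ concat (pencil n bs s)) = [0..<n])"

lemma shift_shift: "shift n i (shift n j x) = shift n (i + j) x"
proof -
  have "shift n i (shift n j x) = (x + 2 * j + 2 * i) mod n"
    by (simp add: shift_def mod_add_left_eq)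
  then show ?thesis
    by (simp add: shift_def algebra_simps)
qed

lemma shift_less: "0 < n \<Longrightarrow> shift n j x < n"
  by (simp add: shift_def)

lemma shift_inverse:
  assumes "x < n" "j \<le> n"
  shows "shift n (n - j) (shift n j x) = x"
proof -
  have "shift n (n - j) (shift n j x) = shift n n x"
    using assms(2) by (simp only: shift_shift le_add_diff_inverse2)
  also have "\<dots> = x"
    using assms(1) by (simp only: shift_def mod_mult_self1 mod_less)
  finally show ?thesis .
qed

lemma inj_on_shift: "j \<le> n \<Longrightarrow> inj_on (shift n j) {..<n}"
  by (rule inj_on_inverseI[where g = "shift n (n - j)"]) (simp add: shift_inverse)

lemma shift_image_points:
  assumes "j \<le> n"
  shows "shift n j ` {..<n} = {..<n}"
  using inj_on_shift[OF assms] shift_less[of n j]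
  by (intro endo_inj_surj) (auto intro: gr0I)

lemma shift_parity: "even n \<Longrightarrow> shift n j x mod 2 = x mod 2"
  by (simp add: shift_def mod_mod_cancel)

lemma shift_div_2: "x < n \<Longrightarrow> shift n (x div 2) (x mod 2) = x"
  by (simp add: shift_def)

lemma shift_to_rep: "a < n \<Longrightarrow> shift n (n - a div 2) a = a mod 2"
  using shift_inverse[of "a mod 2" n "a div 2"] shift_div_2[of a n]
  by (simp add: mod_le_divisor order.strict_trans1[OF mod_less_eq_dividend])

text \<open>Agreement at one point means that n divides 2(i - j), a condition free of the point. For
  even n a translation determines its amount only modulo n/2, so amounts cannot be compared
  directly.\<close>

lemma shift_eq_of_point:
  assumes "shift n i a = shift n j a"
  shows "shift n i b = shift n j b"
proof -
  have "shift n i x = shift n j x \<longleftrightarrow> int n dvd 2 * int i - 2 * int j" for x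
  proof -
    have "shift n i x = shift n j x \<longleftrightarrow> (int x + 2 * int i) mod int n = (int x + 2 * int j) mod int n"
      unfolding of_nat_eq_iff[where 'a = int, symmetric] by (simp add: shift_def zmod_int)
    then show ?thesis
      by (simp add: mod_eq_dvd_iff)
  qed
  with assms show ?thesis
    by blast
qed

section \<open>The geometry developed from base blocks\<close>

text \<open>If a translate of \<open>B\<close> contains \<open>x\<close> as the image of
  \<open>a\<close>, then \<open>a\<close> has the parity of \<open>x\<close>. The shift taking
  \<open>a\<close> to \<open>a mod 2\<close> and on to \<open>x\<close> agrees with the given one at
  \<open>a\<close>, hence everywhere.\<close>

lemma lines_through:
  assumes base: "pent_base n k r bs" and x: "x < n"
  shows "{l \<in> develop n bs. x \<in> l} =
    (\<lambda>T. insert x (set T)) ` set (map (map (shift n (x div 2))) (pencil n bs (x mod 2)))"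
    (is "?L = ?R")
proof -
  let ?P = "\<lambda>B a. map (shift n (x div 2)) (map (shift n (n - a div 2)) (remove1 a B))"
  have blk: "distinct B" "\<And>a. a \<in> set B \<Longrightarrow> a < n" if "B \<in> set bs" for B
    using base that by (auto simp: pent_base_def)
  have move: "shift n (x div 2 + (n - a div 2)) a = x" if "a < n" "a mod 2 = x mod 2" for a
    using that x by (simp only: shift_shift[symmetric] shift_to_rep shift_div_2)
  have ins: "insert x (set (?P B a)) = shift n (x div 2 + (n - a div 2)) ` set B"
    if "B \<in> set bs" "a \<in> set B" "a mod 2 = x mod 2" for B a
  proof -
    have "set B = insert a (set (remove1 a B))"
      using that blk(1)[of B] by auto
    then have "shift n (x div 2 + (n - a div 2)) ` set B
      = insert x (shift n (x div 2 + (n - a div 2)) ` set (remove1 a B))"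
      using move[of a] blk(2)[of B a] that by (metis image_insert)
    then show ?thesis
      by (simp add: image_image shift_shift)
  qed
  have pen: "set (pencil n bs (x mod 2)) =
    {map (shift n (n - a div 2)) (remove1 a B) | B a. B \<in> set bs \<and> a \<in> set B \<and> a mod 2 = x mod 2}"
    by (auto simp: pencil_def)
  have R: "?R = {insert x (set (?P B a)) | B a. B \<in> set bs \<and> a \<in> set B \<and> a mod 2 = x mod 2}"
    unfolding set_map[of _ "pencil n bs (x mod 2)"] pen by blast
  show ?thesis
  proof
    show "?L \<subseteq> ?R"
    proof
      fix l assume "l \<in> ?L"
      then obtain j B a where B: "B \<in> set bs" and l: "l = shift n j ` set B"
        and a: "a \<in> set B" and xa: "x = shift n j a"
        by (auto simp: develop_def)
      have par: "a mod 2 = x mod 2"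
        using base xa by (simp add: shift_parity pent_base_def)
      have "shift n (x div 2 + (n - a div 2)) b = shift n j b" for b
        by (rule shift_eq_of_point[OF trans[OF move[OF blk(2)[OF B a] par] xa]])
      then have "l = insert x (set (?P B a))"
        unfolding l ins[OF B a par] by simp
      then show "l \<in> ?R"
        unfolding R using B a par by blast
    qed
    show "?R \<subseteq> ?L"
    proof
      fix l assume "l \<in> ?R"
      then obtain B a where B: "B \<in> set bs" and a: "a \<in> set B" "a mod 2 = x mod 2"
        and l: "l = insert x (set (?P B a))"
        unfolding R by blast
      then have "l \<in> develop n bs"
        unfolding develop_def using ins[OF B a] by blast
      then show "l \<in> ?L"
        unfolding l by simp
    qed
  qed
qed

text \<open>The partition around \<open>x mod 2\<close> is carried along by the shift by
  \<open>x div 2\<close>, a bijection of the residues that takes \<open>x mod 2\<close> to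
  \<open>x\<close>.\<close>

lemma pent_base_distribution:
  assumes base: "pent_base n k r bs" and x: "x < n"
  shows "distinct (x # opp_list n bs x @ concat (map (map (shift n (x div 2))) (pencil n bs (x mod 2))))"
    and "set (x # opp_list n bs x @ concat (map (map (shift n (x div 2))) (pencil n bs (x mod 2)))) = {..<n}"
proof -
  let ?s = "x mod 2"
  let ?L = "?s # bs ! ?s @ concat (pencil n bs ?s)"
  have s: "?s \<in> {0, 1}"
    by auto
  then have sort: "sort ?L = [0..<n]"
    using base by (simp only: pent_base_def)
  have set: "set ?L = {..<n}"
    using arg_cong[OF sort, of set] by (simp only: set_sort set_upt atLeast0LessThan)
  have dist: "distinct ?L"
    using arg_cong[OF sort, of distinct] by (simp only: distinct_sort distinct_upt)
  have eq: "x # opp_list n bs x @ concat (map (map (shift n (x div 2))) (pencil n bs ?s))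
    = map (shift n (x div 2)) ?L"
    using shift_div_2[OF x] by (simp add: opp_list_def map_concat)
  have le: "x div 2 \<le> n"
    using x by simp
  show "distinct (x # opp_list n bs x @ concat (map (map (shift n (x div 2))) (pencil n bs (x mod 2))))"
    unfolding eq distinct_map set using dist inj_on_shift[OF le] by blast
  show "set (x # opp_list n bs x @ concat (map (map (shift n (x div 2))) (pencil n bs (x mod 2)))) = {..<n}"
    unfolding eq set_map set by (rule shift_image_points[OF le])
qed

lemma
  assumes base: "pent_base n k r bs"
  shows pentagonal_geometry_develop: "pentagonal_geometry k r {..<n} (develop n bs)"
    and opp_develop: "\<And>x. x < n \<Longrightarrow> opp {..<n} (develop n bs) x = set (opp_list n bs x)"
proof -
  have n: "0 < n"
    using base by (simp add: pent_base_def)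
  have card: "card l = k" if l: "l \<in> develop n bs" for l
  proof -
    obtain j B where B: "B \<in> set bs" and l: "l = shift n j ` set B"
      using l by (auto simp: develop_def)
    \<comment> \<open>\<open>develop\<close> admits every \<open>j\<close>, whereas
      \<open>inj_on_shift\<close> asks for an amount of at most \<open>n\<close>.\<close>
    have "shift n j x = shift n (j mod n) x" for x
      unfolding shift_def by (metis mod_add_right_eq mod_mult_right_eq)
    moreover have "inj_on (shift n (j mod n)) (set B)"
      using n B base by (intro inj_on_subset[OF inj_on_shift]) (auto simp: pent_base_def less_imp_le)
    ultimately have "card l = card (set B)"
      by (simp add: l card_image)
    also have "\<dots> = k"
      using B base by (simp add: pent_base_def distinct_card)
    finally show ?thesis .
  qed
  have sub: "l \<subseteq> {..<n}" if "l \<in> develop n bs" for l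
    using that shift_less[OF n] by (auto simp: develop_def)
  have mem: "set (opp_list n bs x) \<in> develop n bs" for x
  proof -
    have "bs ! (x mod 2) \<in> set bs"
      using base by (intro nth_mem) (auto simp: pent_base_def intro: less_le_trans[of _ 2])
    then show ?thesis
      by (auto simp: develop_def opp_list_def)
  qed
  define Ts where "Ts x = map (map (shift n (x div 2))) (pencil n bs (x mod 2))" for x
  have len: "length (Ts x) = r" for x
  proof -
    have "x mod 2 \<in> {0, 1}"
      by auto
    then show ?thesis
      using base by (simp only: pent_base_def length_map Ts_def)
  qed
  have lines: "{l \<in> develop n bs. x \<in> l} = (\<lambda>T. insert x (set T)) ` set (Ts x)"
    and dist: "distinct (x # opp_list n bs x @ concat (Ts x))"
    and cover: "set (x # opp_list n bs x @ concat (Ts x)) = {..<n}" if "x \<in> {..<n}" for x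
    using that lines_through[OF base] pent_base_distribution[OF base]
    unfolding Ts_def lessThan_iff by blast+
  have ne: "{..<n} \<noteq> {}"
    using n by (metis lessThan_iff empty_iff)
  have rk: "1 \<le> r" "2 \<le> k"
    using base by (simp_all only: pent_base_def)
  note I = pentagonal_geometryI[OF ne rk finite_lessThan sub card lines len dist cover mem]
  show "pentagonal_geometry k r {..<n} (develop n bs)"
    by (rule I(1))
  show "\<And>x. x < n \<Longrightarrow> opp {..<n} (develop n bs) x = set (opp_list n bs x)"
    by (rule I(2)) simp_all
qed

section \<open>Absence of opposite line pairs\<close>

text \<open>After wrap-around modulo \<open>n\<close>, half of \<open>shift n j y\<close> may differ
  from \<open>j + y div 2\<close>; yet both amounts take \<open>y mod 2\<close> to
  \<open>shift n j y\<close>, so they give the same translation.\<close>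

lemma opp_list_shift:
  assumes "even n"
  shows "set (opp_list n bs (shift n j y)) = shift n j ` set (opp_list n bs y)"
proof (cases "n = 0")
  case False
  have "shift n (shift n j y div 2) b = shift n (j + y div 2) b" for b
  proof (rule shift_eq_of_point)
    show "shift n (shift n j y div 2) (y mod 2) = shift n (j + y div 2) (y mod 2)"
      using False assms shift_div_2[of "shift n j y" n]
      by (simp add: shift_less shift_parity) (simp add: shift_def)
  qed
  then show ?thesis
    using assms by (simp add: opp_list_def shift_parity image_image shift_shift)
next
  case True
  then show ?thesis
    by (simp add: opp_list_def shift_def image_image algebra_simps)
qed

text \<open>In an opposite line pair, all points of one line share their opposite line; by translation it
  suffices to refute this for the opposite lines of 0 and 1.\<close>

definition no_opposite :: "nat \<Rightarrow> nat list list \<Rightarrow> bool" where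
  "no_opposite n bs \<longleftrightarrow> (\<forall>s\<in>{0, 1}. \<exists>z\<in>set (bs ! s). \<exists>z'\<in>set (bs ! s).
     \<exists>u\<in>set (opp_list n bs z). u \<notin> set (opp_list n bs z'))"

lemma opposite_line_pairs_develop:
  assumes base: "pent_base n k r bs" and no: "no_opposite n bs"
  shows "opposite_line_pairs {..<n} (develop n bs) = {}"
proof -
  have False if l: "l \<in> develop n bs" and ol: "\<forall>x\<in>l. opp {..<n} (develop n bs) x = m"
    and om: "\<forall>x\<in>m. opp {..<n} (develop n bs) x = l" for l m
  proof -
    interpret pentagonal_geometry k r "{..<n}" "develop n bs"
      by (rule pentagonal_geometry_develop[OF base])
    have n: "0 < n" "even n"
      using base by (auto simp: pent_base_def)
    have "l \<noteq> {}"
      using line_card[OF l] by auto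
    then obtain x where x: "x \<in> l" "x < n"
      using line_subset[OF l] by auto
    let ?s = "x mod 2" and ?j = "x div 2"
    have m: "m = shift n ?j ` set (bs ! ?s)"
      using ol x opp_develop[OF base x(2)] by (auto simp: opp_list_def)
    have "?s \<in> {0, 1}"
      by auto
    from bspec[OF no[unfolded no_opposite_def] this]
    obtain z z' u where z: "z \<in> set (bs ! ?s)" and z': "z' \<in> set (bs ! ?s)"
      and u: "u \<in> set (opp_list n bs z)" "u \<notin> set (opp_list n bs z')"
      by blast
    have l_eq: "shift n ?j ` set (opp_list n bs y) = l" if "y \<in> set (bs ! ?s)" for y
    proof -
      have "shift n ?j y \<in> m"
        using m that by blast
      then have "opp {..<n} (develop n bs) (shift n ?j y) = l"
        using om by blast
      then show ?thesis
        using opp_develop[OF base shift_less[OF n(1)]] opp_list_shift[OF n(2)] by metis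
    qed
    \<comment> \<open>The opposite lines of \<open>z\<close> and \<open>z'\<close> have the same
      translate \<open>l\<close>, so cancelling the shift makes them equal.\<close>
    have "inj_on (shift n ?j) {..<n}"
      using x by (intro inj_on_shift) simp
    moreover have "set (opp_list n bs y) \<subseteq> {..<n}" for y
      using n by (auto simp: opp_list_def shift_less)
    ultimately have "set (opp_list n bs z) = set (opp_list n bs z')"
      using l_eq[OF z] l_eq[OF z'] by (metis inj_on_image_eq_iff)
    with u show False
      by simp
  qed
  then show ?thesis
    unfolding opposite_line_pairs_def by blast
qed

section \<open>Base blocks for the five values of r\<close>

text \<open>Leads the unfolding of \<open>[0..<n]\<close> past 0 and \<open>Suc 0\<close> to a
  numeral start, for evaluating \<open>pent_base\<close>.\<close>

lemma upt_0_numeral: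
  "[0..<numeral w] = 0 # [Suc 0..<numeral w]"
  "[Suc 0..<numeral w] = (if Suc 0 < numeral w then Suc 0 # [2..<numeral w] else [])"
  by (simp_all add: upt_rec[of 0] upt_rec[of "Suc 0"] numeral_2_eq_2)

lemmas pent_simps = upt_0_numeral pent_base_def pencil_def no_opposite_def opp_list_def shift_def

text \<open>Counting incidences gives 2r/5 base blocks. Non-collinearity is symmetric, so the points
  opposite to s of its own parity lie at negated differences: 36 = -50 and 7 - 1 = -(81 - 1) modulo
  86.\<close>

definition base_blocks_20 :: "nat list list" where
  "base_blocks_20 =
    [[1, 29, 36, 39, 50],
     [0, 7, 48, 58, 81],
     [0, 2, 8, 32, 63],
     [0, 26, 46, 67, 68],
     [0, 11, 53, 70, 82],
     [1, 28, 47, 62, 71],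
     [1, 10, 15, 23, 83],
     [1, 31, 33, 67, 70]]"

lemma pent_base_20: "pent_base 86 5 20 base_blocks_20"
  by (simp add: pent_simps base_blocks_20_def)

lemma no_opposite_20: "no_opposite 86 base_blocks_20"
  by (simp add: pent_simps base_blocks_20_def)

text \<open>Here and for larger r, symmetry of non-collinearity derives the second block from the
  first: 2d + 1 is opposite to 0 exactly if -2d is opposite to 1.\<close>

definition base_blocks_25 :: "nat list list" where
  "base_blocks_25 =
    [[1, 37, 39, 49, 65],
     [0, 42, 58, 68, 70],
     [0, 22, 35, 89, 98],
     [1, 14, 75, 76, 83],
     [0, 9, 52, 55, 86],
     [0, 56, 60, 83, 101],
     [1, 15, 22, 96, 101],
     [0, 53, 82, 88, 103],
     [1, 41, 63, 74, 88],
     [1, 31, 35, 50, 90]]"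

lemma pent_base_25: "pent_base 106 5 25 base_blocks_25"
  by (simp add: pent_simps base_blocks_25_def)

lemma no_opposite_25: "no_opposite 106 base_blocks_25"
  by (simp add: pent_simps base_blocks_25_def)

definition base_blocks_30 :: "nat list list" where
  "base_blocks_30 =
    [[1, 25, 33, 109, 115],
     [0, 12, 18, 94, 102],
     [0, 14, 16, 74, 119],
     [0, 23, 39, 54, 91],
     [0, 13, 56, 59, 125],
     [0, 9, 46, 63, 65],
     [0, 35, 48, 88, 99],
     [1, 34, 49, 89, 98],
     [0, 67, 96, 101, 106],
     [1, 66, 97, 100, 107],
     [0, 53, 81, 100, 122],
     [1, 52, 80, 101, 123]]"

lemma pent_base_30: "pent_base 126 5 30 base_blocks_30"
  by (simp add: pent_simps base_blocks_30_def)

lemma no_opposite_30: "no_opposite 126 base_blocks_30"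
  by (simp add: pent_simps base_blocks_30_def)

definition base_blocks_35 :: "nat list list" where
  "base_blocks_35 =
    [[1, 57, 83, 111, 145],
     [0, 2, 36, 64, 90],
     [0, 30, 42, 45, 95],
     [1, 14, 105, 110, 117],
     [0, 10, 23, 108, 129],
     [1, 11, 22, 109, 128],
     [0, 8, 75, 93, 132],
     [1, 9, 74, 92, 133],
     [0, 80, 115, 131, 140],
     [1, 81, 114, 130, 141],
     [0, 4, 9, 78, 109],
     [1, 5, 8, 79, 108],
     [0, 32, 79, 102, 126],
     [1, 33, 78, 103, 127]]"

lemma pent_base_35: "pent_base 146 5 35 base_blocks_35"
  by (simp add: pent_simps base_blocks_35_def)

lemma no_opposite_35: "no_opposite 146 base_blocks_35"
  by (simp add: pent_simps base_blocks_35_def)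

definition base_blocks_40 :: "nat list list" where
  "base_blocks_40 =
    [[1, 11, 99, 129, 131],
     [0, 36, 38, 68, 156],
     [0, 44, 52, 77, 86],
     [0, 39, 70, 119, 161],
     [0, 61, 62, 69, 121],
     [0, 3, 37, 60, 107],
     [0, 41, 58, 140, 152],
     [1, 40, 59, 141, 153],
     [0, 74, 102, 137, 155],
     [1, 75, 103, 136, 154],
     [0, 76, 85, 126, 141],
     [1, 77, 84, 127, 140],
     [0, 51, 142, 146, 163],
     [1, 50, 143, 147, 162],
     [0, 23, 89, 144, 160],
     [1, 22, 88, 145, 161]]"

lemma pent_base_40: "pent_base 166 5 40 base_blocks_40"
  by (simp add: pent_simps base_blocks_40_def)

lemma no_opposite_40: "no_opposite 166 base_blocks_40"
  by (simp add: pent_simps base_blocks_40_def)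

theorem lemma4p4:
  fixes r :: nat
  assumes "r \<in> {20, 25, 30, 35, 40}"
  shows "\<exists>(points :: nat set) lns.
    pentagonal_geometry 5 r points lns \<and> opposite_line_pairs points lns = {}"
proof -
  have "\<exists>n bs. pent_base n 5 r bs \<and> no_opposite n bs"
    using assms pent_base_20 no_opposite_20 pent_base_25 no_opposite_25 pent_base_30 no_opposite_30
      pent_base_35 no_opposite_35 pent_base_40 no_opposite_40 by auto
  then show ?thesis
    using pentagonal_geometry_develop opposite_line_pairs_develop by blast
qed

end
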